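(* Let $f_1,\dots,f_m$ be real-valued functions of $Z$, let $\mathcal F=\operatorname{span}(f_1,\dots,f_m)$, and let $\tilde\theta\in\Theta$ be such that the matrix $C_{\tilde\theta}$ with entries $[C_{\tilde\theta}]_{jk}=\frac1n\sum_{i=1}^n f_j(Z_i)f_k(Z_i)(Y_i-g(X_i;\tilde\theta))^2$ is invertible. Then an equivalent formulation of the optimally-weighted GMM estimator is $$\hat\theta^{\mathrm{OWGMM}}\in\operatorname*{argmin}_{\theta\in\Theta}\Psi_n(\theta;\mathcal F,\tilde\theta),$$ that is, $$\operatorname*{argmin}_{\theta\in\Theta}\left\|(\psi_n(f_1;\theta),\dots,\psi_n(f_m;\theta))\right\|_{\tilde\theta}^2=\operatorname*{argmin}_{\theta\in\Theta}\Psi_n(\theta;\mathcal F,\tilde\theta).$$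
   Context: Data $(X_i,Y_i,Z_i)$, $i=1,\dots,n$, are given, with $Y_i\in\mathbb R$. $\{g(\cdot;\theta):\theta\in\Theta\}$ is a parametrized family of real-valued functions of $X$. For real-valued functions $f,h$ of $Z$ (which form a vector space under the usual operations) and $\theta\in\Theta$, define $$\psi_n(f;\theta)=\frac1n\sum_{i=1}^n f(Z_i)(Y_i-g(X_i;\theta)),\qquad \mathcal C_{\theta}(f,h)=\frac1n\sum_{i=1}^n f(Z_i)h(Z_i)(Y_i-g(X_i;\theta))^2,$$ and for a set $\mathcal F$ of such functions, $$\Psi_n(\theta;\mathcal F,\tilde\theta)=\sup_{f\in\mathcal F}\left\{\psi_n(f;\theta)-\frac14\mathcal C_{\tilde\theta}(f,f)\right\}.$$ For $v\in\mathbb R^m$, $\|v\|_{\tilde\theta}^2=v^TC_{\tilde\theta}^{-1}v$. The optimally-weighted GMM (OWGMM) estimator is defined as any $\hat\theta^{\mathrm{OWGMM}}\in\operatorname{argmin}_{\theta\in\Theta}\|(\psi_n(f_1;\theta),\dots,\psi_n(f_m;\theta))\|_{\tilde\theta}^2$. *)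

theory Defs
  imports "HOL-Analysis.Analysis" "HOL-Library.Function_Algebras"
begin

definition psi_n ::
  "nat \<Rightarrow> (nat \<Rightarrow> 'x) \<Rightarrow> (nat \<Rightarrow> real) \<Rightarrow> (nat \<Rightarrow> 'z) \<Rightarrow> ('x \<Rightarrow> 'p \<Rightarrow> real)
    \<Rightarrow> ('z \<Rightarrow> real) \<Rightarrow> 'p \<Rightarrow> real" where
  "psi_n n X Y Z g f \<theta> = (1 / real n) * (\<Sum>i=1..n. f (Z i) * (Y i - g (X i) \<theta>))"

definition Ccov ::
  "nat \<Rightarrow> (nat \<Rightarrow> 'x) \<Rightarrow> (nat \<Rightarrow> real) \<Rightarrow> (nat \<Rightarrow> 'z) \<Rightarrow> ('x \<Rightarrow> 'p \<Rightarrow> real)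
    \<Rightarrow> 'p \<Rightarrow> ('z \<Rightarrow> real) \<Rightarrow> ('z \<Rightarrow> real) \<Rightarrow> real" where
  "Ccov n X Y Z g \<theta> f h =
    (1 / real n) * (\<Sum>i=1..n. f (Z i) * h (Z i) * (Y i - g (X i) \<theta>)\<^sup>2)"

text \<open>The supremum is taken in the extended reals, since it may be infinite for a general
  class \<open>F\<close>.\<close>

definition Psi_n ::
  "nat \<Rightarrow> (nat \<Rightarrow> 'x) \<Rightarrow> (nat \<Rightarrow> real) \<Rightarrow> (nat \<Rightarrow> 'z) \<Rightarrow> ('x \<Rightarrow> 'p \<Rightarrow> real)
    \<Rightarrow> 'p \<Rightarrow> ('z \<Rightarrow> real) set \<Rightarrow> 'p \<Rightarrow> ereal" where
  "Psi_n n X Y Z g \<theta> F \<theta>t =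
    (SUP f\<in>F. ereal (psi_n n X Y Z g f \<theta> - 1/4 * Ccov n X Y Z g \<theta>t f f))"

definition psi_vec ::
  "nat \<Rightarrow> (nat \<Rightarrow> 'x) \<Rightarrow> (nat \<Rightarrow> real) \<Rightarrow> (nat \<Rightarrow> 'z) \<Rightarrow> ('x \<Rightarrow> 'p \<Rightarrow> real)
    \<Rightarrow> ('m::finite \<Rightarrow> 'z \<Rightarrow> real) \<Rightarrow> 'p \<Rightarrow> real ^ 'm" where
  "psi_vec n X Y Z g f \<theta> = (\<chi> j. psi_n n X Y Z g (f j) \<theta>)"

definition Cmat ::
  "nat \<Rightarrow> (nat \<Rightarrow> 'x) \<Rightarrow> (nat \<Rightarrow> real) \<Rightarrow> (nat \<Rightarrow> 'z) \<Rightarrow> ('x \<Rightarrow> 'p \<Rightarrow> real)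
    \<Rightarrow> 'p \<Rightarrow> ('m::finite \<Rightarrow> 'z \<Rightarrow> real) \<Rightarrow> real ^ 'm ^ 'm" where
  "Cmat n X Y Z g \<theta> f = (\<chi> j k. Ccov n X Y Z g \<theta> (f j) (f k))"

definition weighted_sqnorm :: "real ^ 'm ^ 'm \<Rightarrow> real ^ 'm \<Rightarrow> real" where
  "weighted_sqnorm C v = v \<bullet> (matrix_inv C *v v)"

definition argmin_set :: "'p set \<Rightarrow> ('p \<Rightarrow> 'b::ord) \<Rightarrow> 'p set" where
  "argmin_set \<Theta> h = {\<theta>. is_arg_min h (\<lambda>t. t \<in> \<Theta>) \<theta>}"

definition is_OWGMM ::
  "nat \<Rightarrow> (nat \<Rightarrow> 'x) \<Rightarrow> (nat \<Rightarrow> real) \<Rightarrow> (nat \<Rightarrow> 'z) \<Rightarrow> ('x \<Rightarrow> 'p \<Rightarrow> real)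
    \<Rightarrow> 'p set \<Rightarrow> ('m::finite \<Rightarrow> 'z \<Rightarrow> real) \<Rightarrow> 'p \<Rightarrow> 'p \<Rightarrow> bool" where
  "is_OWGMM n X Y Z g \<Theta> f \<theta>t \<theta> \<longleftrightarrow>
    \<theta> \<in> argmin_set \<Theta>
      (\<lambda>\<theta>. weighted_sqnorm (Cmat n X Y Z g \<theta>t f) (psi_vec n X Y Z g f \<theta>))"

text \<open>Function spaces are not an instance of \<open>real_vector\<close>; their pointwise vector space
  structure is supplied by interpretation, on top of the pointwise addition.\<close>

interpretation fun_vs: vector_space "\<lambda>(c::real) (h :: 'z \<Rightarrow> real) z. c * h z"
  by unfold_locales (auto simp: fun_eq_iff algebra_simps)

end

theory Submission
  imports Defs
begin

text \<open>The coefficient vector turns the supremum over the span into that of the concave quadratic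
  \<open>a \<bullet> v - 1/4 a \<bullet> C a\<close>. Completing the square around \<open>a = 2 C\<^sup>-\<^sup>1 v\<close> shows that this supremum equals
  \<open>v \<bullet> C\<^sup>-\<^sup>1 v\<close>, so the two objective functions agree for every parameter.\<close>

text \<open>This lets coefficient vectors replace functions as the index of the supremum. The
  parametrization only has to be onto, so repetitions among the \<open>f j\<close> do no
  harm.\<close>

lemma fun_vs_span_range:
  fixes f :: "'m::finite \<Rightarrow> 'z \<Rightarrow> real"
  shows "fun_vs.span (range f) = range (\<lambda>(a :: real ^ 'm) z. \<Sum>j\<in>UNIV. a $ j * f j z)"
    (is "_ = range ?L")
proof (rule antisym)
  have "fun_vs.subspace (range ?L)"
  proof (rule fun_vs.subspaceI)
    have "?L 0 = 0" by (simp add: fun_eq_iff)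
    then show "0 \<in> range ?L" by (rule range_eqI[OF sym])
  next
    fix x y assume "x \<in> range ?L" "y \<in> range ?L"
    then obtain a b where "x = ?L a" "y = ?L b" by blast
    then have "x + y = ?L (a + b)"
      by (simp add: fun_eq_iff algebra_simps sum.distrib)
    then show "x + y \<in> range ?L" by blast
  next
    fix c x assume "x \<in> range ?L"
    then obtain a where "x = ?L a" by blast
    then have "(\<lambda>z. c * x z) = ?L (c *\<^sub>R a)"
      by (simp add: fun_eq_iff sum_distrib_left mult.assoc)
    then show "(\<lambda>z. c * x z) \<in> range ?L" by blast
  qed
  moreover have "range f \<subseteq> range ?L"
  proof
    fix x assume "x \<in> range f"
    then obtain k where "x = f k" by blast
    then have "x = ?L (axis k 1)"
      by (simp add: fun_eq_iff axis_def if_distrib[where f = "\<lambda>t. t * _"] cong: if_cong)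
    then show "x \<in> range ?L" by blast
  qed
  ultimately show "fun_vs.span (range f) \<subseteq> range ?L" by (rule fun_vs.span_minimal[rotated])
next
  show "range ?L \<subseteq> fun_vs.span (range f)"
  proof clarify
    fix a :: "real ^ 'm"
    \<comment> \<open>Closure of the span under sums concerns sums of functions, so evaluation at
      \<open>z\<close> has to pass through them. For infinite \<open>A\<close> both sides default to
      0.\<close>
    have sum_apply: "(\<Sum>j\<in>A. h j) z = (\<Sum>j\<in>A. h j z)"
      for h :: "'m \<Rightarrow> 'z \<Rightarrow> real" and A z
      by (induction A rule: infinite_finite_induct) auto
    have "(\<Sum>j\<in>UNIV. (\<lambda>z. a $ j * f j z)) \<in> fun_vs.span (range f)"
      by (intro fun_vs.span_sum fun_vs.span_scale fun_vs.span_base rangeI)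
    moreover have "(\<Sum>j\<in>UNIV. (\<lambda>z. a $ j * f j z)) = ?L a"
      by (simp add: fun_eq_iff sum_apply)
    ultimately show "?L a \<in> fun_vs.span (range f)" by simp
  qed
qed

lemma psi_n_linear_combination:
  "psi_n n X Y Z g (\<lambda>z. \<Sum>j\<in>UNIV. a $ j * f j z) \<theta> = a \<bullet> psi_vec n X Y Z g f \<theta>"
proof -
  have "(\<Sum>i=1..n. (\<Sum>j\<in>UNIV. a $ j * f j (Z i)) * (Y i - g (X i) \<theta>))
    = (\<Sum>j\<in>UNIV. a $ j * (\<Sum>i=1..n. f j (Z i) * (Y i - g (X i) \<theta>)))"
    by (simp only: sum_distrib_left sum_distrib_right mult.assoc) (rule sum.swap)
  then show ?thesis
    by (simp add: psi_n_def psi_vec_def inner_vec_def sum_divide_distrib[of _ UNIV])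
qed

lemma Ccov_sum_left:
  "Ccov n X Y Z g \<theta> (\<lambda>z. \<Sum>j\<in>A. c j * f j z) h = (\<Sum>j\<in>A. c j * Ccov n X Y Z g \<theta> (f j) h)"
proof -
  have "(\<Sum>i=1..n. (\<Sum>j\<in>A. c j * f j (Z i)) * h (Z i) * (Y i - g (X i) \<theta>)\<^sup>2)
    = (\<Sum>j\<in>A. c j * (\<Sum>i=1..n. f j (Z i) * h (Z i) * (Y i - g (X i) \<theta>)\<^sup>2))"
    by (simp only: sum_distrib_left sum_distrib_right mult.assoc) (rule sum.swap)
  then show ?thesis
    by (simp add: Ccov_def sum_divide_distrib[of _ A])
qed

lemma Ccov_commute: "Ccov n X Y Z g \<theta> f h = Ccov n X Y Z g \<theta> h f"
  by (simp add: Ccov_def mult.commute)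

lemma Ccov_nonneg: "0 \<le> Ccov n X Y Z g \<theta> f f"
  by (auto simp: Ccov_def intro!: divide_nonneg_nonneg sum_nonneg)

text \<open>Bilinearity: the first argument expands by \<open>Ccov_sum_left\<close>, and symmetry
  carries the second into that position. With \<open>f k\<close> in the other slot, the result is
  row \<open>k\<close> of the matrix-vector product.\<close>

lemma Ccov_linear_combination:
  "Ccov n X Y Z g \<theta> (\<lambda>z. \<Sum>j\<in>UNIV. a $ j * f j z) (\<lambda>z. \<Sum>j\<in>UNIV. a $ j * f j z)
    = a \<bullet> (Cmat n X Y Z g \<theta> f *v a)"
proof -
  have "Ccov n X Y Z g \<theta> (f k) (\<lambda>z. \<Sum>j\<in>UNIV. a $ j * f j z)
    = (Cmat n X Y Z g \<theta> f *v a) $ k" for k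
    by (subst Ccov_commute)
      (simp add: Ccov_sum_left matrix_vector_mult_def Cmat_def mult.commute
        Ccov_commute[of _ _ _ _ _ _ "f k"])
  then show ?thesis
    by (simp add: Ccov_sum_left inner_vec_def)
qed

lemma transpose_Cmat: "transpose (Cmat n X Y Z g \<theta> f) = Cmat n X Y Z g \<theta> f"
  by (simp add: transpose_def Cmat_def vec_eq_iff Ccov_commute)

text \<open>\<open>matrix_inv\<close> is a choice among two-sided inverses, and invertibility
  provides one.\<close>

lemma matrix_inv_right: "invertible A \<Longrightarrow> A ** matrix_inv A = mat 1"
  unfolding invertible_def matrix_inv_def by (rule someI2_ex) auto

lemma SUP_concave_quadratic:
  fixes C :: "real ^ 'm ^ 'm" and v :: "real ^ 'm"
  assumes sym: "transpose C = C" and psd: "\<And>a. 0 \<le> a \<bullet> (C *v a)" and inv: "invertible C"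
  shows "(SUP a. ereal (a \<bullet> v - 1/4 * (a \<bullet> (C *v a)))) = ereal (weighted_sqnorm C v)"
proof -
  \<comment> \<open>By symmetry of \<open>C\<close> the gradient of the objective at
    \<open>a\<close> is \<open>v - 1/2 C a\<close>, which vanishes at
    \<open>a = 2 b\<close>.\<close>
  define b where "b = matrix_inv C *v v"
  have Cb: "C *v b = v"
    by (simp add: b_def matrix_vector_mul_assoc matrix_inv_right[OF inv])
  have norm_eq: "weighted_sqnorm C v = b \<bullet> v"
    by (simp add: weighted_sqnorm_def b_def inner_commute)
  \<comment> \<open>Symmetry moves \<open>C\<close> onto \<open>b\<close>, where
    \<open>C b = v\<close>. This evaluates the cross terms of the square below.\<close>
  have "b \<bullet> (C *v a) = a \<bullet> v" for a
    using dot_lmul_matrix[of b C a] transpose_matrix_vector[of C b] sym Cb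
    by (simp add: inner_commute)
  then have square: "a \<bullet> v - 1/4 * (a \<bullet> (C *v a))
      = weighted_sqnorm C v - 1/4 * ((a - 2 *\<^sub>R b) \<bullet> (C *v (a - 2 *\<^sub>R b)))" for a
    by (simp add: norm_eq matrix_vector_mult_diff_distrib matrix_vector_mult_scaleR Cb
        inner_diff_left inner_diff_right algebra_simps)
  show ?thesis
  proof (rule antisym)
    show "(SUP a. ereal (a \<bullet> v - 1/4 * (a \<bullet> (C *v a)))) \<le> ereal (weighted_sqnorm C v)"
      unfolding square by (rule SUP_least) (simp add: psd)
    show "ereal (weighted_sqnorm C v) \<le> (SUP a. ereal (a \<bullet> v - 1/4 * (a \<bullet> (C *v a))))"
      \<comment> \<open>At this point the subtracted square is zero, so the bound is
        attained.\<close>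
      unfolding square by (rule SUP_upper2[of "2 *\<^sub>R b"]) simp_all
  qed
qed

lemma Psi_n_span_eq_weighted_sqnorm:
  assumes "invertible (Cmat n X Y Z g \<theta>t f)"
  shows "Psi_n n X Y Z g \<theta> (fun_vs.span (range f)) \<theta>t
    = ereal (weighted_sqnorm (Cmat n X Y Z g \<theta>t f) (psi_vec n X Y Z g f \<theta>))"
proof -
  \<comment> \<open>The quadratic form is \<open>Ccov\<close> of a linear combination with itself,
    an average of squares.\<close>
  have "0 \<le> a \<bullet> (Cmat n X Y Z g \<theta>t f *v a)" for a
    using Ccov_nonneg by (simp flip: Ccov_linear_combination)
  from SUP_concave_quadratic[OF transpose_Cmat this assms] show ?thesis
    by (simp add: Psi_n_def fun_vs_span_range image_image psi_n_linear_combination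
        Ccov_linear_combination)
qed

theorem corollary1:
  fixes n :: nat
    and X :: "nat \<Rightarrow> 'x" and Y :: "nat \<Rightarrow> real" and Z :: "nat \<Rightarrow> 'z"
    and g :: "'x \<Rightarrow> 'p \<Rightarrow> real"
    and \<Theta> :: "'p set" and \<theta>t :: 'p
    and f :: "'m::finite \<Rightarrow> 'z \<Rightarrow> real"
    and F :: "('z \<Rightarrow> real) set"
  assumes "n \<ge> 1"
    and "F = fun_vs.span (range f)"
    and "\<theta>t \<in> \<Theta>"
    and "invertible (Cmat n X Y Z g \<theta>t f)"
  shows "(\<forall>\<theta>. is_OWGMM n X Y Z g \<Theta> f \<theta>t \<theta> \<longleftrightarrow>
              \<theta> \<in> argmin_set \<Theta> (\<lambda>\<theta>. Psi_n n X Y Z g \<theta> F \<theta>t)) \<and>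
         argmin_set \<Theta>
             (\<lambda>\<theta>. weighted_sqnorm (Cmat n X Y Z g \<theta>t f) (psi_vec n X Y Z g f \<theta>)) =
           argmin_set \<Theta> (\<lambda>\<theta>. Psi_n n X Y Z g \<theta> F \<theta>t)"
  \<comment> \<open>The objectives agree up to \<open>ereal\<close>, which preserves and reflects
    the strict order defining minimizers.\<close>
  using assms(4)
  by (simp add: assms(2) is_OWGMM_def Psi_n_span_eq_weighted_sqnorm argmin_set_def is_arg_min_def)

end
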